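(* The deformed cross-product is a two-parameter formal ternary hom-Nambu-Lie deformation of the cross-product in $\mathbb{R}^4$.
   Context: $\mathbb{N}$ denotes the natural numbers including zero, $K$ a field of characteristic zero, and $S_3$ the symmetric group on three letters. A ternary hom-Nambu-Lie algebra $(V,[\cdot,\cdot,\cdot],(\alpha,\beta))$ over $K$ consists of a $K$-vector space $V$, two $K$-linear maps $\alpha,\beta\colon V\to V$ (the twisting maps), and a $K$-trilinear map $[\cdot,\cdot,\cdot]\colon V\times V\times V\to V$ that is skew-symmetric, i.e. $[x_{\sigma(1)},x_{\sigma(2)},x_{\sigma(3)}]=\operatorname{sgn}(\sigma)[x_1,x_2,x_3]$ for all $x_1,x_2,x_3\in V$ and $\sigma\in S_3$, and satisfies, for all $x_1,\dots,x_5\in V$, the ternary hom-Nambu identity \begin{align*} [\alpha(x_1),\beta(x_2),[x_3,x_4,x_5]]={}&[[x_1,x_2,x_3],\alpha(x_4),\beta(x_5)]+[\alpha(x_3),[x_1,x_2,x_4],\beta(x_5)]\\ &+[\alpha(x_3),\beta(x_4),[x_1,x_2,x_5]]. \end{align*} A ternary Nambu-Lie algebra $(V,[\cdot,\cdot,\cdot])$ is the case $\alpha=\beta=\mathrm{id}_V$, i.e. it stands for $(V,[\cdot,\cdot,\cdot],(\mathrm{id}_V,\mathrm{id}_V))$. The cross-product in $\mathbb{R}^4$: let $\mathbb{R}^4$ be the four-dimensional Euclidean vector space over $\mathbb{R}$ with standard basis $\{\vec{e}_1,\vec{e}_2,\vec{e}_3,\vec{e}_4\}$, and write $\vec{x}=\sum_i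 x^i\vec{e}_i$, $\vec{y}=\sum_i y^i\vec{e}_i$, $\vec{z}=\sum_i z^i\vec{e}_i$ with $x^i,y^i,z^i\in\mathbb{R}$, $1\le i\le 4$. The cross-product is the ternary Nambu-Lie algebra $(\mathbb{R}^4,[\cdot,\cdot,\cdot])$ over $\mathbb{R}$ with bracket $$[\vec{x},\vec{y},\vec{z}]:=\vec{x}\times\vec{y}\times\vec{z}:=\begin{vmatrix} x^1 & y^1 & z^1 & \vec{e}_1 \\ x^2 & y^2 & z^2 & \vec{e}_2 \\ x^3 & y^3 & z^3 & \vec{e}_3 \\ x^4 & y^4 & z^4 & \vec{e}_4 \end{vmatrix}.$$ The deformed cross-product in $\mathbb{R}^4$: for $\theta:=(\theta_1,\theta_2)$ with $\theta_1,\theta_2\in\mathbb{R}$, let $\rho_\theta\colon\mathbb{R}^4\to\mathbb{R}^4$ be the linear map with matrix $$\rho_\theta=\begin{pmatrix} \cos\theta_1 & 0 & -\sin\theta_1 & 0 \\ 0 & \cos\theta_2 & 0 & -\sin\theta_2 \\ \sin\theta_1 & 0 & \cos\theta_1 & 0 \\ 0 & \sin\theta_2 & 0 & \cos\theta_2 \end{pmatrix}$$ with respect to the standard basis (its $l$-th column holds the coordinates of $\rho_\theta(\vec{e}_l)$). With $[\cdot,\cdot,\cdot]_\theta:=\rho_\theta\circ[\cdot,\cdot,\cdot]$, the ternary hom-Nambu-Lie algebra $(\mathbb{R}^4,[\cdot,\cdot,\cdot]_\theta,(\rho_\theta,\rho_\theta))$ is called a deformed cross-product in $\mathbb{R}^4$.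 Formal deformations: for $n\in\mathbb{N}_{>0}$, an $n$-parameter formal ternary hom-Nambu-Lie deformation of a ternary hom-Nambu-Lie algebra $(V,[\cdot,\cdot,\cdot]_0,(\alpha_0,\beta_0))$ over $K$ is a ternary hom-Nambu-Lie algebra $(V[[t_1,\dots,t_n]],[\cdot,\cdot,\cdot]_t,(\alpha_t,\beta_t))$ over $K[[t_1,\dots,t_n]]$ (same notion, with scalars $K[[t_1,\dots,t_n]]$), where $t:=(t_1,\dots,t_n)$ and $$[\cdot,\cdot,\cdot]_t=\sum_{i\in\mathbb{N}^n}[\cdot,\cdot,\cdot]_i\,t^i,\quad \alpha_t=\sum_{i\in\mathbb{N}^n}\alpha_i t^i,\quad \beta_t=\sum_{i\in\mathbb{N}^n}\beta_i t^i.$$ Here $i:=(i_1,\dots,i_n)\in\mathbb{N}^n$, $t^i:=t_1^{i_1}\cdots t_n^{i_n}$, each $[\cdot,\cdot,\cdot]_i\colon V\times V\times V\to V$ is a $K$-trilinear operation and $\alpha_i,\beta_i\colon V\to V$ are $K$-linear maps, extended homogeneously to a $K[[t_1,\dots,t_n]]$-trilinear operation and $K[[t_1,\dots,t_n]]$-linear maps, respectively, on $V[[t_1,\dots,t_n]]$. A map $f\colon V\to V$ is extended homogeneously when $f(at^i):=f(a)t^i$ for all $a\in V$ and $i\in\mathbb{N}^n$; the case of ternary maps is analogous. The maps $[\cdot,\cdot,\cdot]_0,\alpha_0,\beta_0$ are those with index $i=(0,\dots,0)$. *)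

theory Defs
  imports "HOL-Analysis.Analysis"
begin

text \<open>
  Both \<open>K[[t\<^sub>1,\<dots>,t\<^sub>n]]\<close> and \<open>V[[t\<^sub>1,\<dots>,t\<^sub>n]]\<close> are instances of the following type, with \<open>'n\<close> a
  type of \<open>n\<close> elements and \<open>nat^'n\<close> the multi-indices.
\<close>

typedef ('a, 'n) mfps = "UNIV :: (nat ^ 'n::finite \<Rightarrow> 'a) set"
  morphisms mfps_nth Abs_mfps
  by simp

lemma mfps_nth_Abs [simp]: "mfps_nth (Abs_mfps f) = f"
  by (simp add: Abs_mfps_inverse)

lemma mfps_eqI: "(\<And>k. mfps_nth x k = mfps_nth y k) \<Longrightarrow> x = y"
  by (metis ext mfps_nth_inject)

definition antidiag :: "nat ^ 'n \<Rightarrow> ((nat ^ 'n) \<times> (nat ^ 'n)) set"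
  where "antidiag k = {(i, j). i + j = k}"

lemma finite_multi_index_le: "finite {i :: nat ^ 'n::finite. \<forall>m. i $ m \<le> k $ m}"
proof (rule finite_subset)
  let ?P = "PiE UNIV (\<lambda>m. {..k $ m})"
  show "{i :: nat ^ 'n. \<forall>m. i $ m \<le> k $ m} \<subseteq> vec_lambda ` ?P"
  proof
    fix i :: "nat ^ 'n" assume "i \<in> {i. \<forall>m. i $ m \<le> k $ m}"
    then have "vec_nth i \<in> ?P" by auto
    then show "i \<in> vec_lambda ` ?P" by (metis image_eqI vec_nth_inverse)
  qed
  show "finite (vec_lambda ` ?P)"
    by (intro finite_imageI finite_PiE) auto
qed

lemma finite_antidiag [simp]: "finite (antidiag (k :: nat ^ 'n::finite))"
proof (rule finite_subset)
  let ?L = "{i :: nat ^ 'n. \<forall>m. i $ m \<le> k $ m}"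
  show "antidiag k \<subseteq> ?L \<times> ?L" by (auto simp: antidiag_def)
  show "finite (?L \<times> ?L)" by (intro finite_cartesian_product finite_multi_index_le)
qed

lemma antidiag_0: "antidiag (0 :: nat ^ 'n::finite) = {(0, 0)}"
  by (auto simp: antidiag_def vec_eq_iff)

lemma sum_antidiag_swap:
  "(\<Sum>(i, j)\<in>antidiag k. g i j) = (\<Sum>(i, j)\<in>antidiag k. g j i)"
  by (rule sum.reindex_bij_witness[where i = prod.swap and j = prod.swap])
     (auto simp: antidiag_def add.commute)

lemma sum_antidiag_assoc:
  fixes g :: "nat ^ 'n::finite \<Rightarrow> nat ^ 'n \<Rightarrow> nat ^ 'n \<Rightarrow> 'a::comm_monoid_add"
  shows "(\<Sum>(i, j)\<in>antidiag k. \<Sum>(p, q)\<in>antidiag j. g i p q) =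
         (\<Sum>(i, j)\<in>antidiag k. \<Sum>(p, q)\<in>antidiag i. g p q j)"
proof -
  have "(\<Sum>(i, j)\<in>antidiag k. \<Sum>(p, q)\<in>antidiag j. g i p q) =
        (\<Sum>((i, j), (p, q))\<in>(SIGMA x:antidiag k. antidiag (snd x)). g i p q)"
    by (simp add: sum.Sigma split_beta)
  also have "\<dots> = (\<Sum>((i, j), (p, q))\<in>(SIGMA x:antidiag k. antidiag (fst x)). g p q j)"
    by (rule sum.reindex_bij_witness
          [where i = "\<lambda>((i, j), (p, q)). ((p, q + j), (q, j))"
             and j = "\<lambda>((i, j), (p, q)). ((i + p, q), (i, p))"])
       (auto simp: antidiag_def add.assoc)
  also have "\<dots> = (\<Sum>(i, j)\<in>antidiag k. \<Sum>(p, q)\<in>antidiag i. g p q j)"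
    by (simp add: sum.Sigma split_beta)
  finally show ?thesis .
qed

lemma sum_antidiag_0_left:
  fixes g :: "nat ^ 'n::finite \<Rightarrow> 'a::comm_monoid_add"
  shows "(\<Sum>(i, j)\<in>antidiag k. if i = 0 then g j else 0) = g k"
proof -
  have "(\<Sum>(i, j)\<in>antidiag k. if i = 0 then g j else 0) =
        (\<Sum>(i, j)\<in>{(0 :: nat ^ 'n, k)}. if i = 0 then g j else 0)"
  proof (rule sum.mono_neutral_right)
    show "{(0 :: nat ^ 'n, k)} \<subseteq> antidiag k" by (simp add: antidiag_def)
    show "\<forall>x\<in>antidiag k - {(0 :: nat ^ 'n, k)}. (case x of (i, j) \<Rightarrow> if i = 0 then g j else 0) = 0"
      by (auto simp: antidiag_def split: if_split_asm)
  qed simp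
  then show ?thesis by simp
qed

instantiation mfps :: (ab_group_add, finite) ab_group_add
begin
definition "0 = Abs_mfps (\<lambda>k. 0)"
definition "x + y = Abs_mfps (\<lambda>k. mfps_nth x k + mfps_nth y k)"
definition "x - y = Abs_mfps (\<lambda>k. mfps_nth x k - mfps_nth y k)"
definition "- x = Abs_mfps (\<lambda>k. - mfps_nth x k)"
instance
  by standard
     (auto intro!: mfps_eqI
        simp: zero_mfps_def plus_mfps_def minus_mfps_def uminus_mfps_def algebra_simps)
end

lemma mfps_nth_group [simp]:
  "mfps_nth 0 k = 0"
  "mfps_nth (x + y) k = mfps_nth x k + mfps_nth y k"
  "mfps_nth (x - y) k = mfps_nth x k - mfps_nth y k"
  "mfps_nth (- x) k = - mfps_nth x k"
  by (simp_all add: zero_mfps_def plus_mfps_def minus_mfps_def uminus_mfps_def)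

instantiation mfps :: (comm_ring_1, finite) comm_ring_1
begin
definition "1 = Abs_mfps (\<lambda>k. if k = 0 then 1 else 0)"
definition "x * y = Abs_mfps (\<lambda>k. \<Sum>(i, j)\<in>antidiag k. mfps_nth x i * mfps_nth y j)"
instance
proof
  fix a b c :: "('a, 'b) mfps"
  show "a * b * c = a * (b * c)"
    by (rule mfps_eqI)
       (simp add: times_mfps_def sum_distrib_left sum_distrib_right split_beta mult.assoc
          sum_antidiag_assoc[where g = "\<lambda>p q r. mfps_nth a p * (mfps_nth b q * mfps_nth c r)",
            unfolded split_beta])
  show "a * b = b * a"
    by (rule mfps_eqI)
       (simp add: times_mfps_def, subst sum_antidiag_swap, simp add: mult.commute)
  show "1 * a = a"
  proof (rule mfps_eqI)
    fix k
    have "mfps_nth (1 * a) k = (\<Sum>(i, j)\<in>antidiag k. if i = 0 then mfps_nth a j else 0)"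
      by (auto simp: times_mfps_def one_mfps_def intro!: sum.cong)
    then show "mfps_nth (1 * a) k = mfps_nth a k"
      by (simp only: sum_antidiag_0_left)
  qed
  show "(a + b) * c = a * c + b * c"
    by (rule mfps_eqI) (simp add: times_mfps_def split_beta sum.distrib algebra_simps)
  show "(0::('a, 'b) mfps) \<noteq> 1"
  proof
    assume "(0::('a, 'b) mfps) = 1"
    then have "mfps_nth (0::('a, 'b) mfps) 0 = mfps_nth 1 0" by simp
    then show False by (simp add: one_mfps_def)
  qed
qed
end

definition mfps_scale ::
    "('k::comm_ring_1 \<Rightarrow> 'v::ab_group_add \<Rightarrow> 'v) \<Rightarrow> ('k, 'n::finite) mfps \<Rightarrow> ('v, 'n) mfps \<Rightarrow> ('v, 'n) mfps"
  where "mfps_scale s c x = Abs_mfps (\<lambda>k. \<Sum>(i, j)\<in>antidiag k. s (mfps_nth c i) (mfps_nth x j))"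

lemma module_mfps_scale:
  assumes "module s"
  shows "module (mfps_scale s :: ('k::comm_ring_1, 'n::finite) mfps \<Rightarrow> ('v::ab_group_add, 'n) mfps \<Rightarrow> _)"
proof -
  interpret module s by (rule assms)
  show ?thesis
  proof
    fix a b :: "('k, 'n) mfps" and x y :: "('v, 'n) mfps"
    show "mfps_scale s a (x + y) = mfps_scale s a x + mfps_scale s a y"
      by (rule mfps_eqI) (simp add: mfps_scale_def split_beta sum.distrib scale_right_distrib)
    show "mfps_scale s (a + b) x = mfps_scale s a x + mfps_scale s b x"
      by (rule mfps_eqI) (simp add: mfps_scale_def split_beta sum.distrib scale_left_distrib)
    show "mfps_scale s a (mfps_scale s b x) = mfps_scale s (a * b) x"
      by (rule mfps_eqI)
         (simp add: mfps_scale_def times_mfps_def scale_sum_right scale_sum_left split_beta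
            sum_antidiag_assoc[where g = "\<lambda>p q r. s (mfps_nth a p * mfps_nth b q) (mfps_nth x r)",
              unfolded split_beta])
    show "mfps_scale s 1 x = x"
    proof (rule mfps_eqI)
      fix k
      have "mfps_nth (mfps_scale s 1 x) k = (\<Sum>(i, j)\<in>antidiag k. if i = 0 then mfps_nth x j else 0)"
        by (auto simp: mfps_scale_def one_mfps_def intro!: sum.cong)
      then show "mfps_nth (mfps_scale s 1 x) k = mfps_nth x k"
        by (simp only: sum_antidiag_0_left)
    qed
  qed
qed

definition mfps_monom :: "'a::zero \<Rightarrow> nat ^ 'n::finite \<Rightarrow> ('a, 'n) mfps"
  where "mfps_monom a i = Abs_mfps (\<lambda>k. if k = i then a else 0)"

definition trilinear ::
    "('k::comm_ring_1 \<Rightarrow> 'v::ab_group_add \<Rightarrow> 'v) \<Rightarrow> ('v \<Rightarrow> 'v \<Rightarrow> 'v \<Rightarrow> 'v) \<Rightarrow> bool"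
  where "trilinear s f \<longleftrightarrow>
    (\<forall>y z. module_hom s s (\<lambda>x. f x y z)) \<and>
    (\<forall>x z. module_hom s s (\<lambda>y. f x y z)) \<and>
    (\<forall>x y. module_hom s s (\<lambda>z. f x y z))"

text \<open>
  The scalars form a commutative ring, so that the same notion covers algebras over a field \<open>K\<close>
  and over \<open>K[[t\<^sub>1,\<dots>,t\<^sub>n]]\<close>.
\<close>

locale ternary_hom_nambu_lie_algebra = module scale
  for scale :: "'k::comm_ring_1 \<Rightarrow> 'v::ab_group_add \<Rightarrow> 'v" +
  fixes bracket :: "'v \<Rightarrow> 'v \<Rightarrow> 'v \<Rightarrow> 'v"
    and \<alpha> \<beta> :: "'v \<Rightarrow> 'v"
  assumes linear_alpha: "module_hom scale scale \<alpha>"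
    and linear_beta: "module_hom scale scale \<beta>"
    and trilinear_bracket: "trilinear scale bracket"
    and skew_symmetric: "\<sigma> permutes {1, 2, 3::nat} \<Longrightarrow>
      bracket (x (\<sigma> 1)) (x (\<sigma> 2)) (x (\<sigma> 3)) =
      scale (of_int (sign \<sigma>)) (bracket (x 1) (x 2) (x 3))"
    and hom_nambu_identity:
      "bracket (\<alpha> x1) (\<beta> x2) (bracket x3 x4 x5) =
       bracket (bracket x1 x2 x3) (\<alpha> x4) (\<beta> x5) +
       bracket (\<alpha> x3) (bracket x1 x2 x4) (\<beta> x5) +
       bracket (\<alpha> x3) (\<beta> x4) (bracket x1 x2 x5)"

text \<open>
  The homogeneous extensions of a linear and of a trilinear map from \<open>V\<close> to \<open>V[[t\<^sub>1,\<dots>,t\<^sub>n]]\<close>, in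
  terms of coefficients; their values on monomials are in \<open>hom_ext1_monom\<close> and \<open>hom_ext3_monom\<close>.
\<close>

definition hom_ext1 :: "('v \<Rightarrow> 'v) \<Rightarrow> ('v, 'n::finite) mfps \<Rightarrow> ('v, 'n) mfps"
  where "hom_ext1 f x = Abs_mfps (\<lambda>k. f (mfps_nth x k))"

definition hom_ext3 ::
    "('v \<Rightarrow> 'v \<Rightarrow> 'v \<Rightarrow> 'v::ab_group_add) \<Rightarrow>
     ('v, 'n::finite) mfps \<Rightarrow> ('v, 'n) mfps \<Rightarrow> ('v, 'n) mfps \<Rightarrow> ('v, 'n) mfps"
  where "hom_ext3 f x y z = Abs_mfps (\<lambda>k.
    \<Sum>(a, b, c) | a + b + c = k. f (mfps_nth x a) (mfps_nth y b) (mfps_nth z c))"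

lemma hom_ext1_monom:
  assumes "f 0 = 0"
  shows "hom_ext1 f (mfps_monom a i) = mfps_monom (f a) i"
  using assms by (auto intro!: mfps_eqI simp: hom_ext1_def mfps_monom_def)

lemma finite_triples: "finite {(a, b, c). a + b + c = (k :: nat ^ 'n::finite)}"
proof (rule finite_subset)
  let ?L = "{i :: nat ^ 'n. \<forall>m. i $ m \<le> k $ m}"
  show "{(a, b, c). a + b + c = k} \<subseteq> ?L \<times> ?L \<times> ?L" by auto
  show "finite (?L \<times> ?L \<times> ?L)" by (intro finite_cartesian_product finite_multi_index_le)
qed

lemma hom_ext3_monom:
  fixes f :: "'v \<Rightarrow> 'v \<Rightarrow> 'v \<Rightarrow> 'v::ab_group_add" and i j l :: "nat ^ 'n::finite"
  assumes "\<And>y z. f 0 y z = 0" "\<And>x z. f x 0 z = 0" "\<And>x y. f x y 0 = 0"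
  shows "hom_ext3 f (mfps_monom a i) (mfps_monom b j) (mfps_monom c l) =
         mfps_monom (f a b c) (i + j + l)"
proof (rule mfps_eqI)
  fix k
  let ?g = "\<lambda>(p, q, r). f (if p = i then a else 0) (if q = j then b else 0) (if r = l then c else 0)"
  have "(\<Sum>t\<in>{(p, q, r). p + q + r = k}. ?g t) =
        (\<Sum>t\<in>{(p, q, r). p + q + r = k} \<inter> {(i, j, l)}. ?g t)"
  proof (rule sum.mono_neutral_right)
    have "?g (p, q, r) = 0" if "(p, q, r) \<noteq> (i, j, l)" for p q r
      using that by (cases "p = i"; cases "q = j"; cases "r = l") (simp_all add: assms)
    then show "\<forall>t\<in>{(p, q, r). p + q + r = k} - {(p, q, r). p + q + r = k} \<inter> {(i, j, l)}. ?g t = 0"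
      by blast
  qed (auto simp: finite_triples)
  also have "\<dots> = (if k = i + j + l then f a b c else 0)"
    by auto
  finally show "mfps_nth (hom_ext3 f (mfps_monom a i) (mfps_monom b j) (mfps_monom c l)) k =
      mfps_nth (mfps_monom (f a b c) (i + j + l)) k"
    by (simp add: hom_ext3_def mfps_monom_def)
qed

text \<open>
  \<open>\<Sum>\<^sub>i F\<^sub>i t\<^sup>i\<close>, where each \<open>F\<^sub>i\<close> is extended homogeneously: the coefficient of \<open>t\<^sup>k\<close> in
  \<open>\<Sum>\<^sub>i F\<^sub>i(x) t\<^sup>i\<close> is the finite sum over \<open>i + j = k\<close> of the coefficients of \<open>t\<^sup>j\<close> in \<open>F\<^sub>i(x)\<close>.
\<close>

definition series_map1 ::
    "(nat ^ 'n \<Rightarrow> 'v \<Rightarrow> 'v::ab_group_add) \<Rightarrow> ('v, 'n::finite) mfps \<Rightarrow> ('v, 'n) mfps"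
  where "series_map1 F x =
    Abs_mfps (\<lambda>k. \<Sum>(i, j)\<in>antidiag k. mfps_nth (hom_ext1 (F i) x) j)"

definition series_map3 ::
    "(nat ^ 'n \<Rightarrow> 'v \<Rightarrow> 'v \<Rightarrow> 'v \<Rightarrow> 'v::ab_group_add) \<Rightarrow>
     ('v, 'n::finite) mfps \<Rightarrow> ('v, 'n) mfps \<Rightarrow> ('v, 'n) mfps \<Rightarrow> ('v, 'n) mfps"
  where "series_map3 F x y z =
    Abs_mfps (\<lambda>k. \<Sum>(i, j)\<in>antidiag k. mfps_nth (hom_ext3 (F i) x y z) j)"

text \<open>
  A \<open>CARD('n)\<close>-parameter deformation of \<open>(V, bracket0, (\<alpha>0, \<beta>0))\<close>, given by the families of
  coefficient maps.
\<close>

locale formal_hom_nambu_lie_deformation =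
  base: ternary_hom_nambu_lie_algebra scale bracket0 \<alpha>0 \<beta>0
  for scale :: "'k::field_char_0 \<Rightarrow> 'v::ab_group_add \<Rightarrow> 'v"
    and bracket0 :: "'v \<Rightarrow> 'v \<Rightarrow> 'v \<Rightarrow> 'v"
    and \<alpha>0 \<beta>0 :: "'v \<Rightarrow> 'v" +
  fixes bracket :: "nat ^ 'n::finite \<Rightarrow> 'v \<Rightarrow> 'v \<Rightarrow> 'v \<Rightarrow> 'v"
    and \<alpha> \<beta> :: "nat ^ 'n \<Rightarrow> 'v \<Rightarrow> 'v"
  assumes trilinear_coeff: "trilinear scale (bracket i)"
    and linear_alpha_coeff: "module_hom scale scale (\<alpha> i)"
    and linear_beta_coeff: "module_hom scale scale (\<beta> i)"
    and bracket_0: "bracket 0 = bracket0"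
    and alpha_0: "\<alpha> 0 = \<alpha>0"
    and beta_0: "\<beta> 0 = \<beta>0"
    and formal_algebra:
      "ternary_hom_nambu_lie_algebra (mfps_scale scale :: ('k, 'n) mfps \<Rightarrow> ('v, 'n) mfps \<Rightarrow> ('v, 'n) mfps)
         (series_map3 bracket) (series_map1 \<alpha>) (series_map1 \<beta>)"

text \<open>
  The determinant with last column \<open>e\<^sub>1, \<dots>, e\<^sub>4\<close> is read as a formal linear combination of the
  \<open>e\<^sub>l\<close>; the coefficient of \<open>e\<^sub>l\<close> is the determinant whose last column is the coordinate vector
  of \<open>e\<^sub>l\<close>.  The rows of \<open>vector [x, y, z, w]\<close> are \<open>x, y, z, w\<close>, hence the transpose.
\<close>

definition cross4 :: "real ^ 4 \<Rightarrow> real ^ 4 \<Rightarrow> real ^ 4 \<Rightarrow> real ^ 4"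
  where "cross4 x y z =
    (\<Sum>l\<in>UNIV. det (transpose (vector [x, y, z, axis l 1])) *\<^sub>R axis l 1)"

definition rot_matrix :: "real ^ 2 \<Rightarrow> real ^ 4 ^ 4"
  where "rot_matrix \<theta> = vector
    [vector [cos (\<theta> $ 1), 0, - sin (\<theta> $ 1), 0],
     vector [0, cos (\<theta> $ 2), 0, - sin (\<theta> $ 2)],
     vector [sin (\<theta> $ 1), 0, cos (\<theta> $ 1), 0],
     vector [0, sin (\<theta> $ 2), 0, cos (\<theta> $ 2)]]"

definition rot :: "real ^ 2 \<Rightarrow> real ^ 4 \<Rightarrow> real ^ 4"
  where "rot \<theta> x = rot_matrix \<theta> *v x"

definition deformed_cross4 :: "real ^ 2 \<Rightarrow> real ^ 4 \<Rightarrow> real ^ 4 \<Rightarrow> real ^ 4 \<Rightarrow> real ^ 4"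
  where "deformed_cross4 \<theta> x y z = rot \<theta> (cross4 x y z)"

definition multi_power :: "real ^ 'n::finite \<Rightarrow> nat ^ 'n \<Rightarrow> real"
  where "multi_power \<theta> i = (\<Prod>m\<in>UNIV. (\<theta> $ m) ^ (i $ m))"

lemma vector_4:
  "(vector [a, b, c, d] :: 'a::zero ^ 4) $ 1 = a"
  "(vector [a, b, c, d] :: 'a::zero ^ 4) $ 2 = b"
  "(vector [a, b, c, d] :: 'a::zero ^ 4) $ 3 = c"
  "(vector [a, b, c, d] :: 'a::zero ^ 4) $ 4 = d"
  by (simp_all add: vector_def)

end

theory Submission
  imports Defs
begin

text \<open>
  Expanding \<open>cos\<close> and \<open>sin\<close> turns \<open>\<rho>\<^sub>\<theta>\<close> into a matrix over \<open>\<real>[[t\<^sub>1,t\<^sub>2]]\<close> whose entries still satisfy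
  \<open>c\<^sup>2 + s\<^sup>2 = 1\<close>.  Over any commutative ring, such a double rotation \<open>\<rho>\<close> commutes with the cross
  product, and the cross product satisfies the Nambu identity.  Hence both sides of the
  hom-Nambu identity for \<open>\<rho> \<circ> [\<cdot>,\<cdot>,\<cdot>]\<close> with twisting map \<open>\<rho>\<close> are \<open>\<rho>\<^sup>2\<close> applied to the corresponding
  sides of the Nambu identity.  The identification of \<open>\<real>\<^sup>4[[t\<^sub>1,t\<^sub>2]]\<close> with \<open>\<real>[[t\<^sub>1,t\<^sub>2]]\<^sup>4\<close> transports
  this to formal series.
\<close>

section \<open>Cross product and double rotation over a commutative ring\<close>

lemma det_4:
  "det (A :: 'a::comm_ring_1^4^4) =
    A$1$1 * (A$2$2*A$3$3*A$4$4 + A$2$3*A$3$4*A$4$2 + A$2$4*A$3$2*A$4$3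
      - A$2$2*A$3$4*A$4$3 - A$2$3*A$3$2*A$4$4 - A$2$4*A$3$3*A$4$2)
  - A$1$2 * (A$2$1*A$3$3*A$4$4 + A$2$3*A$3$4*A$4$1 + A$2$4*A$3$1*A$4$3
      - A$2$1*A$3$4*A$4$3 - A$2$3*A$3$1*A$4$4 - A$2$4*A$3$3*A$4$1)
  + A$1$3 * (A$2$1*A$3$2*A$4$4 + A$2$2*A$3$4*A$4$1 + A$2$4*A$3$1*A$4$2
      - A$2$1*A$3$4*A$4$2 - A$2$2*A$3$1*A$4$4 - A$2$4*A$3$2*A$4$1)
  - A$1$4 * (A$2$1*A$3$2*A$4$3 + A$2$2*A$3$3*A$4$1 + A$2$3*A$3$1*A$4$2
      - A$2$1*A$3$3*A$4$2 - A$2$2*A$3$1*A$4$3 - A$2$3*A$3$2*A$4$1)"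
proof -
  have f: "finite {2::4, 3, 4}" "1 \<notin> {2::4, 3, 4}" "finite {3::4, 4}" "2 \<notin> {3::4, 4}"
    "finite {4::4}" "3 \<notin> {4::4}" by auto
  show ?thesis
    unfolding det_def UNIV_4
    unfolding sum_over_permutations_insert[OF f(1,2)] sum_over_permutations_insert[OF f(3,4)]
      sum_over_permutations_insert[OF f(5,6)] permutes_sing
    by (simp add: sign_swap_id permutation_swap_id sign_compose sign_id permutation_compose
          swap_id_eq) (simp add: algebra_simps)
qed

text \<open>The minor in rows \<open>i\<close>, \<open>j\<close>, \<open>k\<close> of the matrix
  with columns \<open>x\<close>, \<open>y\<close>, \<open>z\<close>, expanded along
  \<open>x\<close>.\<close>

definition minor3 :: "4 \<Rightarrow> 4 \<Rightarrow> 4 \<Rightarrow> 'a::comm_ring_1 ^ 4 \<Rightarrow> 'a ^ 4 \<Rightarrow> 'a ^ 4 \<Rightarrow> 'a"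
  where "minor3 i j k x y z =
    x $ i * (y $ j * z $ k - y $ k * z $ j) - x $ j * (y $ i * z $ k - y $ k * z $ i) +
    x $ k * (y $ i * z $ j - y $ j * z $ i)"

text \<open>Laplace expansion of the defining determinant along its last column, with signs
  (-1)^(l+4). It makes sense over any commutative ring, power series included.\<close>

definition cross4_ring :: "'a::comm_ring_1 ^ 4 \<Rightarrow> 'a ^ 4 \<Rightarrow> 'a ^ 4 \<Rightarrow> 'a ^ 4"
  where "cross4_ring x y z = vector
    [- minor3 2 3 4 x y z, minor3 1 3 4 x y z, - minor3 1 2 4 x y z, minor3 1 2 3 x y z]"

text \<open>Cosines and sines are free parameters, so that either real numbers or their formal
  series can be inserted.\<close>

definition rot4 :: "'a::comm_ring_1 \<Rightarrow> 'a \<Rightarrow> 'a \<Rightarrow> 'a \<Rightarrow> 'a ^ 4 \<Rightarrow> 'a ^ 4"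
  where "rot4 c s c' s' x = vector
    [c * x $ 1 - s * x $ 3, c' * x $ 2 - s' * x $ 4, s * x $ 1 + c * x $ 3, s' * x $ 2 + c' * x $ 4]"

lemma cross4_eq: "cross4 x y z = cross4_ring x y z"
  by (simp add: cross4_def cross4_ring_def minor3_def vec_eq_iff forall_4 sum_4 vector_4 det_4
      transpose_def axis_def algebra_simps)

lemma rot_eq: "rot \<theta> = rot4 (cos (\<theta> $ 1)) (sin (\<theta> $ 1)) (cos (\<theta> $ 2)) (sin (\<theta> $ 2))"
  by (simp add: fun_eq_iff rot_def rot_matrix_def rot4_def matrix_vector_mult_def vec_eq_iff
      forall_4 sum_4 vector_4)

lemma cross4_ring_nambu:
  "cross4_ring u v (cross4_ring x y z) =
     cross4_ring (cross4_ring u v x) y z + cross4_ring x (cross4_ring u v y) z +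
     cross4_ring x y (cross4_ring u v z)"
  by (simp add: cross4_ring_def minor3_def vec_eq_iff forall_4 vector_4 algebra_simps)

text \<open>Determinants are multiplicative, and the rotation matrix has determinant
  \<open>c\<^sup>2 + s\<^sup>2\<close>.\<close>

lemma minor2_rotation:
  fixes c s :: "'a::comm_ring_1"
  assumes "c\<^sup>2 + s\<^sup>2 = 1"
  shows "(c * a - s * b) * (s * a' + c * b') - (s * a + c * b) * (c * a' - s * b') = a * b' - b * a'"
proof -
  have "(c * a - s * b) * (s * a' + c * b') - (s * a + c * b) * (c * a' - s * b') =
    (c\<^sup>2 + s\<^sup>2) * (a * b' - b * a')"
    by (simp add: algebra_simps power2_eq_square)
  with assms show ?thesis by simp
qed

text \<open>Expansion along row \<open>i\<close> leaves the 2-by-2 minors in rows \<open>j\<close>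
  and \<open>k\<close>, to which rotation invariance applies.\<close>

lemma minor3_expand_row:
  "minor3 i j k x y z =
    x $ i * (y $ j * z $ k - y $ k * z $ j) - y $ i * (x $ j * z $ k - x $ k * z $ j) +
    z $ i * (x $ j * y $ k - x $ k * y $ j)"
  by (simp add: minor3_def algebra_simps)

text \<open>
  Each component of the cross product expands into 2-by-2 minors of one of the two rotated
  coordinate planes, and these minors are rotation invariant.
\<close>

lemma cross4_ring_rot4:
  assumes "c\<^sup>2 + s\<^sup>2 = 1" "c'\<^sup>2 + s'\<^sup>2 = 1"
  shows "cross4_ring (rot4 c s c' s' x) (rot4 c s c' s' y) (rot4 c s c' s' z) =
    rot4 c s c' s' (cross4_ring x y z)"
proof -
  let ?R = "rot4 c s c' s'"
  have minor2: "(?R u) $ 1 * (?R v) $ 3 - (?R u) $ 3 * (?R v) $ 1 = u $ 1 * v $ 3 - u $ 3 * v $ 1"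
    "(?R u) $ 2 * (?R v) $ 4 - (?R u) $ 4 * (?R v) $ 2 = u $ 2 * v $ 4 - u $ 4 * v $ 2" for u v
    by (simp_all add: rot4_def vector_4 minor2_rotation[OF assms(1)] minor2_rotation[OF assms(2)])
  have minor3_rot: "minor3 4 1 3 (?R x) (?R y) (?R z) =
     (?R x) $ 4 * (y $ 1 * z $ 3 - y $ 3 * z $ 1) - (?R y) $ 4 * (x $ 1 * z $ 3 - x $ 3 * z $ 1) +
    (?R z) $ 4 * (x $ 1 * y $ 3 - x $ 3 * y $ 1)"
    "minor3 2 1 3 (?R x) (?R y) (?R z) =
     (?R x) $ 2 * (y $ 1 * z $ 3 - y $ 3 * z $ 1) - (?R y) $ 2 * (x $ 1 * z $ 3 - x $ 3 * z $ 1) +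
    (?R z) $ 2 * (x $ 1 * y $ 3 - x $ 3 * y $ 1)"
    "minor3 3 2 4 (?R x) (?R y) (?R z) =
     (?R x) $ 3 * (y $ 2 * z $ 4 - y $ 4 * z $ 2) - (?R y) $ 3 * (x $ 2 * z $ 4 - x $ 4 * z $ 2) +
    (?R z) $ 3 * (x $ 2 * y $ 4 - x $ 4 * y $ 2)"
    "minor3 1 2 4 (?R x) (?R y) (?R z) =
     (?R x) $ 1 * (y $ 2 * z $ 4 - y $ 4 * z $ 2) - (?R y) $ 1 * (x $ 2 * z $ 4 - x $ 4 * z $ 2) +
    (?R z) $ 1 * (x $ 2 * y $ 4 - x $ 4 * y $ 2)"
    by (simp_all add: minor3_expand_row minor2)
  \<comment> \<open>The rows are reordered so that the last two span a rotated plane, {1, 3} or {2,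
    4}, as in \<open>minor3_rot\<close>.\<close>
  have permute: "minor3 2 3 4 u v w = - minor3 3 2 4 u v w" "minor3 1 3 4 u v w = minor3 4 1 3 u v w"
     "minor3 1 2 3 u v w = - minor3 2 1 3 u v w" for u v w :: "'a^4"
    by (simp_all add: minor3_def algebra_simps)
  show ?thesis
    unfolding cross4_ring_def permute minor3_rot
    \<comment> \<open>The quadratic relations are used up in \<open>minor2\<close>: both sides are
      now linear in the rotation parameters and agree as polynomials.\<close>
    by (simp add: vec_eq_iff forall_4 vector_4 rot4_def) (simp add: minor3_def algebra_simps)
qed

section \<open>Verification of the algebra axioms in coordinates\<close>

lemma skew_permutes:
  fixes f :: "'v \<Rightarrow> 'v \<Rightarrow> 'v \<Rightarrow> 'v::ab_group_add" and scale :: "'k::comm_ring_1 \<Rightarrow> 'v \<Rightarrow> 'v"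
  assumes "module scale"
    and swap12: "\<And>x y z. f y x z = - f x y z" and swap23: "\<And>x y z. f x z y = - f x y z"
    and "\<sigma> permutes {1, 2, 3::nat}"
  shows "f (x (\<sigma> 1)) (x (\<sigma> 2)) (x (\<sigma> 3)) = scale (of_int (sign \<sigma>)) (f (x 1) (x 2) (x 3))"
proof -
  interpret module scale by fact
  have swap13: "f z y x = - f x y z" for x y z
    by (metis swap12 swap23 minus_minus)
  have "finite {1, 2, 3::nat}" by simp
  with \<open>\<sigma> permutes {1, 2, 3}\<close> show ?thesis
  proof (induction \<sigma> arbitrary: x rule: permutes_induct)
    case id
    then show ?case by (simp add: sign_id)
  next
    case (swap a b p)
    let ?t = "Transposition.transpose a b"
    have "f (x (?t 1)) (x (?t 2)) (x (?t 3)) = - f (x 1) (x 2) (x 3)"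
      using swap.hyps(1-3) by (auto simp: Transposition.transpose_def
          simp del: One_nat_def intro: swap12 swap13 swap23)
    moreover have "sign (?t \<circ> p) = - sign p"
      using sign_compose[OF permutation_swap_id permutes_imp_permutation[OF _ \<open>p permutes _\<close>]]
        \<open>a \<noteq> b\<close>
      by (simp add: sign_swap_id)
    ultimately show ?case
      \<comment> \<open>The arguments of \<open>f\<close> are those of \<open>p\<close> applied to
        the relabelled family, hence \<open>x\<close> is arbitrary in the induction; undoing the
        relabelling costs one sign.\<close>
      using swap.IH[of "x \<circ> ?t"] by (simp add: o_def)
  qed
qed

lemma rot4_add: "rot4 c s c' s' (x + y) = rot4 c s c' s' x + rot4 c s c' s' y"
  by (simp add: rot4_def vec_eq_iff forall_4 vector_4 algebra_simps)

lemma rot4_scale: "rot4 c s c' s' (a *s x) = a *s rot4 c s c' s' x"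
  by (simp add: rot4_def vec_eq_iff forall_4 vector_4 algebra_simps)

lemma rot4_minus: "rot4 c s c' s' (- x) = - rot4 c s c' s' x"
  by (simp add: rot4_def vec_eq_iff forall_4 vector_4 algebra_simps)

lemma cross4_ring_add:
  "cross4_ring (x + x') y z = cross4_ring x y z + cross4_ring x' y z"
  "cross4_ring x (y + y') z = cross4_ring x y z + cross4_ring x y' z"
  "cross4_ring x y (z + z') = cross4_ring x y z + cross4_ring x y z'"
  by (simp_all add: cross4_ring_def minor3_def vec_eq_iff forall_4 vector_4 algebra_simps)

lemma cross4_ring_scale:
  "cross4_ring (a *s x) y z = a *s cross4_ring x y z"
  "cross4_ring x (a *s y) z = a *s cross4_ring x y z"
  "cross4_ring x y (a *s z) = a *s cross4_ring x y z"
  by (simp_all add: cross4_ring_def minor3_def vec_eq_iff forall_4 vector_4 algebra_simps)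

lemma cross4_ring_skew:
  "cross4_ring y x z = - cross4_ring x y z"
  "cross4_ring x z y = - cross4_ring x y z"
  by (simp_all add: cross4_ring_def minor3_def vec_eq_iff forall_4 vector_4 algebra_simps)

text \<open>Every axiom is an equation between vectors, so an injective linear coordinate map
  reduces it to \<open>cross4_ring\<close> and \<open>rot4\<close>. The lemma serves both the real
  cross product and the formal algebra.\<close>

lemma ternary_hom_nambu_lie_algebra_coords:
  fixes scale :: "'k::comm_ring_1 \<Rightarrow> 'v::ab_group_add \<Rightarrow> 'v" and coord :: "'v \<Rightarrow> 'k ^ 4"
  assumes mod: "module scale" and inj: "inj coord"
    and add: "\<And>x y. coord (x + y) = coord x + coord y"
    and scale: "\<And>a x. coord (scale a x) = a *s coord x"
    and rotation: "c\<^sup>2 + s\<^sup>2 = 1" "c'\<^sup>2 + s'\<^sup>2 = 1"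
    and bracket: "\<And>x y z. coord (bracket x y z) =
      rot4 c s c' s' (cross4_ring (coord x) (coord y) (coord z))"
    and alpha: "\<And>x. coord (\<alpha> x) = rot4 c s c' s' (coord x)"
  shows "ternary_hom_nambu_lie_algebra scale bracket \<alpha> \<alpha>"
proof -
  interpret module scale by fact
  have minus: "coord (- x) = - coord x" for x
    using scale[of "- 1" x] by (simp add: vec_eq_iff)
  have homI: "module_hom scale scale g"
    if "\<And>x y. coord (g (x + y)) = coord (g x) + coord (g y)"
      and "\<And>a x. coord (g (scale a x)) = a *s coord (g x)" for g
    using that by (intro module_hom.intro module_hom_axioms.intro mod) (auto intro: injD[OF inj] simp: add scale)
  note simps = add scale bracket alpha rot4_add rot4_scale cross4_ring_add cross4_ring_scale
  have hom_alpha: "module_hom scale scale \<alpha>"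
    by (rule homI) (simp_all add: simps)
  show ?thesis
  proof (intro ternary_hom_nambu_lie_algebra.intro ternary_hom_nambu_lie_algebra_axioms.intro
      mod hom_alpha)
    show "trilinear scale bracket"
      unfolding trilinear_def by (intro conjI allI homI) (simp_all add: simps)
    show "bracket (x (\<sigma> 1)) (x (\<sigma> 2)) (x (\<sigma> 3)) =
        scale (of_int (sign \<sigma>)) (bracket (x 1) (x 2) (x 3))"
      if "\<sigma> permutes {1, 2, 3::nat}" for x \<sigma>
    proof (rule skew_permutes[OF mod _ _ that])
      show "bracket y x z = - bracket x y z" for x y z
        by (rule injD[OF inj]) (simp add: minus bracket rot4_minus cross4_ring_skew(1)[of "coord y"])
      show "bracket x z y = - bracket x y z" for x y z
        by (rule injD[OF inj]) (simp add: minus bracket rot4_minus cross4_ring_skew(2)[of _ "coord z"])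
    qed
    show "bracket (\<alpha> x1) (\<alpha> x2) (bracket x3 x4 x5) =
       bracket (bracket x1 x2 x3) (\<alpha> x4) (\<alpha> x5) +
       bracket (\<alpha> x3) (bracket x1 x2 x4) (\<alpha> x5) +
       bracket (\<alpha> x3) (\<alpha> x4) (bracket x1 x2 x5)" for x1 x2 x3 x4 x5
      \<comment> \<open>Inside each outer bracket every argument, inner bracket included, carries
        one rotation, which \<open>cross4_ring_rot4\<close> pulls out.\<close>
      by (rule injD[OF inj])
        (simp add: add bracket alpha cross4_ring_rot4[OF rotation] flip: rot4_add cross4_ring_nambu)
  qed
qed

section \<open>Series of vectors as vectors of series\<close>

definition mfps_coord :: "('a ^ 'm, 'n::finite) mfps \<Rightarrow> ('a, 'n) mfps ^ 'm"
  where "mfps_coord x = (\<chi> l. Abs_mfps (\<lambda>k. mfps_nth x k $ l))"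

lemma mfps_nth_coord [simp]: "mfps_nth (mfps_coord x $ l) k = mfps_nth x k $ l"
  by (simp add: mfps_coord_def)

lemma inj_mfps_coord: "inj mfps_coord"
proof (rule injI, rule mfps_eqI)
  fix x y :: "('a ^ 'm, 'n::finite) mfps" and k
  assume "mfps_coord x = mfps_coord y"
  then show "mfps_nth x k = mfps_nth y k"
    by (metis mfps_nth_coord vec_eq_iff)
qed

lemma mfps_coord_add: "mfps_coord (x + y) = mfps_coord x + mfps_coord y"
  by (auto simp: vec_eq_iff intro!: mfps_eqI)

lemma mfps_coord_scale: "mfps_coord (mfps_scale scaleR a x) = a *s mfps_coord x"
  by (auto simp: vec_eq_iff mfps_scale_def times_mfps_def split_beta intro!: mfps_eqI)

text \<open>Brings the iterated Cauchy product to the index set of \<open>hom_ext3\<close>.\<close>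

lemma mfps_nth_mult3:
  "mfps_nth (x * (y * z)) k =
    (\<Sum>(a, b, c) | a + b + c = k. mfps_nth x a * (mfps_nth y b * mfps_nth z c))"
proof -
  have "mfps_nth (x * (y * z)) k = (\<Sum>((i, j), (p, q))\<in>(SIGMA t:antidiag k. antidiag (snd t)).
      mfps_nth x i * (mfps_nth y p * mfps_nth z q))"
    by (simp add: times_mfps_def sum.Sigma split_beta sum_distrib_left)
  also have "\<dots> = (\<Sum>(a, b, c) | a + b + c = k. mfps_nth x a * (mfps_nth y b * mfps_nth z c))"
    by (rule sum.reindex_bij_witness[where i = "\<lambda>(a, b, c). ((a, b + c), (b, c))"
          and j = "\<lambda>((i, j), (p, q)). (i, p, q)"])
      (auto simp: antidiag_def add.assoc)
  finally show ?thesis .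
qed

lemma mfps_nth_minor3:
  "mfps_nth (minor3 i j l (mfps_coord x) (mfps_coord y) (mfps_coord z)) k =
    (\<Sum>(a, b, c) | a + b + c = k. minor3 i j l (mfps_nth x a) (mfps_nth y b) (mfps_nth z c))"
  by (simp add: minor3_def right_diff_distrib mfps_nth_mult3 split_beta sum.distrib sum_subtractf)

text \<open>The components of the cross product are sums of signed triple products of coordinates,
  and the homogeneous extension of a triple product is the product of series.\<close>

lemma mfps_coord_hom_ext3_cross4:
  "mfps_coord (hom_ext3 cross4 x y z) =
    cross4_ring (mfps_coord x) (mfps_coord y) (mfps_coord z)"
  unfolding vec_eq_iff forall_4
  by (auto simp: cross4_ring_def vector_4 mfps_nth_minor3 hom_ext3_def cross4_eq split_beta
      sum_negf intro!: mfps_eqI)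

text \<open>Additivity moves \<open>A i\<close> through the finite sum in \<open>hom_ext3\<close>;
  the formal bracket thus factors into the undeformed bracket followed by a series of linear
  maps.\<close>

lemma series_map3_comp:
  assumes "\<And>i. Modules.additive (A i)"
  shows "series_map3 (\<lambda>i x y z. A i (f x y z)) x y z = series_map1 A (hom_ext3 f x y z)"
  by (rule mfps_eqI)
    (simp add: series_map3_def series_map1_def hom_ext3_def hom_ext1_def split_beta
       Modules.additive.sum[OF assms])

text \<open>As \<open>rot4\<close> is linear in its parameters, the sum over
  \<open>i + j = k\<close> is the Cauchy product of parameter series and coordinates.\<close>

lemma mfps_coord_series_map1_rot4:
  "mfps_coord (series_map1 (\<lambda>i. rot4 (mfps_nth c i) (mfps_nth s i) (mfps_nth c' i) (mfps_nth s' i)) x) =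
    rot4 c s c' s' (mfps_coord x)"
  unfolding vec_eq_iff forall_4
  by (auto simp: rot4_def vector_4 series_map1_def hom_ext1_def times_mfps_def split_beta
      sum.distrib sum_subtractf intro!: mfps_eqI)

section \<open>Univariate series read as series in the single variable
  \<open>t\<^sub>m\<close>\<close>

definition mfps_of_fps :: "'n::finite \<Rightarrow> 'a::zero fps \<Rightarrow> ('a, 'n) mfps"
  where "mfps_of_fps m f = Abs_mfps (\<lambda>i. if i = axis m (i $ m) then fps_nth f (i $ m) else 0)"

lemma mfps_nth_of_fps_axis [simp]: "mfps_nth (mfps_of_fps m f) (axis m n) = fps_nth f n"
  by (simp add: mfps_of_fps_def)

lemma mfps_of_fps_1: "mfps_of_fps m 1 = (1 :: ('a::comm_ring_1, 'b::finite) mfps)"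
proof (rule mfps_eqI)
  fix k :: "nat ^ 'b"
  have "k = 0 \<longleftrightarrow> k = axis m (k $ m) \<and> k $ m = 0"
    by (metis axis_eq_0_iff zero_index)
  then show "mfps_nth (mfps_of_fps m 1) k = mfps_nth (1 :: ('a, 'b) mfps) k"
    by (simp add: mfps_of_fps_def one_mfps_def) (metis gr0I)
qed

lemma mfps_of_fps_add: "mfps_of_fps m (f + g) = mfps_of_fps m f + mfps_of_fps m g"
  by (rule mfps_eqI) (simp add: mfps_of_fps_def)

text \<open>Only multi-indices on the axis \<open>m\<close> carry coefficients. Splitting
  \<open>axis m n\<close> into two of these is splitting \<open>n\<close>, which gives the
  univariate Cauchy product; an index off the axis has no such splitting.\<close>

lemma mfps_of_fps_mult:
  fixes f g :: "'a::comm_ring_1 fps"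
  shows "mfps_of_fps m (f * g) = mfps_of_fps m f * mfps_of_fps m g"
proof (rule mfps_eqI)
  fix k :: "nat ^ 'b"
  let ?F = "\<lambda>(i, j). mfps_nth (mfps_of_fps m f) i * mfps_nth (mfps_of_fps m g) j"
  have axis_add: "axis m p + axis m q = (axis m (p + q) :: nat ^ 'b)" for p q
    by (simp add: axis_def vec_eq_iff)
  have supp: "\<exists>p q. i = axis m p \<and> j = axis m q" if "?F (i, j) \<noteq> 0" for i j
    using that by (auto simp: mfps_of_fps_def split: if_splits)
  have "(\<Sum>t\<in>antidiag k. ?F t) = mfps_nth (mfps_of_fps m (f * g)) k"
  proof (cases "k = axis m (k $ m)")
    case True
    define n where "n = k $ m"
    have k: "k = axis m n" using True n_def by simp
    let ?h = "\<lambda>p. (axis m p, axis m (n - p)) :: (nat ^ 'b) \<times> (nat ^ 'b)"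
    have "(\<Sum>t\<in>antidiag k. ?F t) = (\<Sum>t\<in>?h ` {0..n}. ?F t)"
    proof (rule sum.mono_neutral_right)
      show "?h ` {0..n} \<subseteq> antidiag k"
        by (auto simp: antidiag_def k axis_add)
      have "(i, j) \<in> ?h ` {0..n}" if ij: "(i, j) \<in> antidiag k" and nz: "?F (i, j) \<noteq> 0" for i j
      proof -
        obtain p q where pq: "i = axis m p" "j = axis m q" using supp[OF nz] by blast
        then have "p + q = n"
          using ij by (auto simp: antidiag_def k axis_add axis_eq_axis)
        then show ?thesis using pq by (intro image_eqI[of _ _ p]) auto
      qed
      then show "\<forall>t\<in>antidiag k - ?h ` {0..n}. ?F t = 0" by fastforce
    qed simp
    also have "\<dots> = (\<Sum>p\<in>{0..n}. fps_nth f p * fps_nth g (n - p))"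
      by (subst sum.reindex) (auto simp: inj_on_def axis_eq_axis)
    finally show ?thesis by (simp add: k fps_mult_nth)
  next
    case False
    have "?F t = 0" if t: "t \<in> antidiag k" for t
    proof (rule ccontr)
      assume "?F t \<noteq> 0"
      then obtain p q where "t = (axis m p, axis m q)" using supp by (cases t) blast
      then have "k = axis m (p + q)" using t by (simp add: antidiag_def axis_add)
      then show False using False by simp
    qed
    then show ?thesis using False by (simp add: mfps_of_fps_def sum.neutral)
  qed
  then show "mfps_nth (mfps_of_fps m (f * g)) k = mfps_nth (mfps_of_fps m f * mfps_of_fps m g) k"
    by (simp add: times_mfps_def)
qed

section \<open>Evaluation of the series at \<theta>\<close>

lemma multi_power_axis: "multi_power \<theta> (axis m n) = (\<theta> $ m) ^ n"
proof -
  have "multi_power \<theta> (axis m n) = (\<Prod>j\<in>UNIV. if j = m then (\<theta> $ m) ^ n else 1)"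
    unfolding multi_power_def by (intro prod.cong) (auto simp: axis_def)
  then show ?thesis by simp
qed

text \<open>Absolute convergence makes the ordered sum unconditional; it is then carried to the axis
  \<open>m\<close>, off which all terms vanish.\<close>

lemma has_sum_mfps_of_fps:
  assumes sum: "(\<lambda>n. fps_nth f n * (\<theta> $ m) ^ n) sums S"
    and norm: "summable (\<lambda>n. norm (fps_nth f n * (\<theta> $ m) ^ n))"
  shows "((\<lambda>i. multi_power \<theta> i * mfps_nth (mfps_of_fps m f) i) has_sum S) UNIV"
proof -
  let ?g = "\<lambda>i. multi_power \<theta> i * mfps_nth (mfps_of_fps m f) i"
  have "((\<lambda>n. fps_nth f n * (\<theta> $ m) ^ n) has_sum S) UNIV"
    by (rule norm_summable_imp_has_sum[OF norm sum])
  also have "(\<lambda>n. fps_nth f n * (\<theta> $ m) ^ n) = ?g \<circ> axis m"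
    by (auto simp: multi_power_axis)
  finally have "(?g has_sum S) (range (axis m))"
    by (subst has_sum_reindex) (simp_all add: inj_on_def axis_eq_axis o_def)
  also have "(?g has_sum S) (range (axis m)) \<longleftrightarrow> (?g has_sum S) UNIV"
    by (rule has_sum_cong_neutral) (auto simp: mfps_of_fps_def)
  finally show ?thesis .
qed

lemma fps_nth_cos: "fps_nth (fps_cos 1) n = cos_coeff n"
  by (simp add: fps_cos_def cos_coeff_def)

lemma fps_nth_sin: "fps_nth (fps_sin 1) n = sin_coeff n"
  by (simp add: fps_sin_def sin_coeff_def)

lemma has_sum_mfps_cos:
  "((\<lambda>i. multi_power \<theta> i * mfps_nth (mfps_of_fps m (fps_cos 1)) i) has_sum cos (\<theta> $ m)) UNIV"
  using cos_converges[of "\<theta> $ m"] summable_norm_cos[of "\<theta> $ m"]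
  by (intro has_sum_mfps_of_fps) (simp_all add: fps_nth_cos)

lemma has_sum_mfps_sin:
  "((\<lambda>i. multi_power \<theta> i * mfps_nth (mfps_of_fps m (fps_sin 1)) i) has_sum sin (\<theta> $ m)) UNIV"
  using sin_converges[of "\<theta> $ m"] summable_norm_sin[of "\<theta> $ m"]
  by (intro has_sum_mfps_of_fps) (simp_all add: fps_nth_sin)

text \<open>The embedding preserves sums, products and 1, so the identity of formal univariate
  series carries over.\<close>

lemma mfps_cos_sin:
  "(mfps_of_fps m (fps_cos 1))\<^sup>2 + (mfps_of_fps m (fps_sin 1))\<^sup>2 = (1 :: (real, 'n::finite) mfps)"
proof -
  have "(mfps_of_fps m (fps_cos 1))\<^sup>2 + (mfps_of_fps m (fps_sin 1))\<^sup>2 =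
      (mfps_of_fps m ((fps_cos 1)\<^sup>2 + (fps_sin 1)\<^sup>2) :: (real, 'n::finite) mfps)"
    by (simp only: power2_eq_square mfps_of_fps_add mfps_of_fps_mult)
  then show ?thesis by (simp only: fps_sin_cos_sum_of_squares mfps_of_fps_1)
qed

text \<open>The Taylor coefficients of the rotation as a function of its angles: the first plane
  depends on \<open>t\<^sub>1\<close> and the second on \<open>t\<^sub>2\<close>.\<close>

definition rot_coeff :: "nat ^ 2 \<Rightarrow> real ^ 4 \<Rightarrow> real ^ 4"
  where "rot_coeff i = rot4
    (mfps_nth (mfps_of_fps 1 (fps_cos 1)) i) (mfps_nth (mfps_of_fps 1 (fps_sin 1)) i)
    (mfps_nth (mfps_of_fps 2 (fps_cos 1)) i) (mfps_nth (mfps_of_fps 2 (fps_sin 1)) i)"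

text \<open>Separates the parameters from the vector, so that convergence of the four scalar series
  gives convergence of the rotation.\<close>

lemma rot4_decompose:
  fixes x :: "real ^ 4"
  shows "rot4 c s c' s' x = c *\<^sub>R vector [x $ 1, 0, x $ 3, 0] + s *\<^sub>R vector [- x $ 3, 0, x $ 1, 0] +
    c' *\<^sub>R vector [0, x $ 2, 0, x $ 4] + s' *\<^sub>R vector [0, - x $ 4, 0, x $ 2]"
  by (simp add: rot4_def vec_eq_iff forall_4 vector_4)

lemma has_sum_scaleR_left:
  fixes v :: "'a::real_normed_vector"
  assumes "(f has_sum S) A"
  shows "((\<lambda>i. f i *\<^sub>R v) has_sum S *\<^sub>R v) A"
  by (rule has_sum_bounded_linear[OF bounded_linear_scaleR_left assms])

lemma has_sum_rot_coeff: "((\<lambda>i. multi_power \<theta> i *\<^sub>R rot_coeff i x) has_sum rot \<theta> x) UNIV"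
  unfolding rot_coeff_def rot_eq rot4_decompose scaleR_add_right scaleR_scaleR
  by (intro has_sum_add has_sum_scaleR_left has_sum_mfps_cos has_sum_mfps_sin)

section \<open>The cross product and its deformation\<close>

lemma module_scaleR: "module (scaleR :: real \<Rightarrow> 'a::real_vector \<Rightarrow> 'a)"
  by standard (simp_all add: scaleR_add_right scaleR_add_left)

lemma module_hom_rot_coeff: "module_hom scaleR scaleR (rot_coeff i)"
  by (intro module_hom.intro module_hom_axioms.intro module_scaleR)
    (simp add: rot_coeff_def rot4_add, metis rot_coeff_def rot4_scale scalar_mult_eq_scaleR)

text \<open>The constant terms are those of cosine and sine, 1 and 0.\<close>

lemma rot_coeff_0: "rot_coeff 0 = id"
proof -
  have "mfps_nth (mfps_of_fps m f) 0 = fps_nth f 0" for m :: 2 and f :: "real fps"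
    using mfps_nth_of_fps_axis[of m f 0] by (simp add: axis_def zero_vec_def)
  then show ?thesis
    by (simp add: fun_eq_iff rot_coeff_def rot4_def vec_eq_iff forall_4 vector_4 fps_nth_cos fps_nth_sin)
qed

text \<open>This is the case of angle zero, where \<open>rot4\<close> is the identity.\<close>

lemma cross4_algebra: "ternary_hom_nambu_lie_algebra scaleR cross4 id id"
  by (rule ternary_hom_nambu_lie_algebra_coords[where coord = id and c = 1 and s = 0 and c' = 1 and s' = 0,
        OF module_scaleR])
    (simp_all add: scalar_mult_eq_scaleR cross4_eq rot4_def vec_eq_iff forall_4 vector_4)

lemma formal_cross4_algebra:
  "ternary_hom_nambu_lie_algebra (mfps_scale scaleR)
     (series_map3 (\<lambda>i x y z. rot_coeff i (cross4 x y z))) (series_map1 rot_coeff) (series_map1 rot_coeff)"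
proof -
  let ?C = "\<lambda>m. mfps_of_fps m (fps_cos 1) :: (real, 2) mfps"
  let ?S = "\<lambda>m. mfps_of_fps m (fps_sin 1) :: (real, 2) mfps"
  have additive: "Modules.additive (rot_coeff i)" for i
    by (simp add: Modules.additive_def rot_coeff_def rot4_add)
  have rot: "mfps_coord (series_map1 rot_coeff x) = rot4 (?C 1) (?S 1) (?C 2) (?S 2) (mfps_coord x)" for x
    unfolding rot_coeff_def[abs_def] by (rule mfps_coord_series_map1_rot4)
  show ?thesis
    by (rule ternary_hom_nambu_lie_algebra_coords[OF module_mfps_scale[OF module_scaleR]
          inj_mfps_coord mfps_coord_add mfps_coord_scale mfps_cos_sin mfps_cos_sin])
      (simp_all only: series_map3_comp[OF additive] rot mfps_coord_hom_ext3_cross4)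
qed

theorem proposition3:
  shows "\<exists>(bracket :: nat ^ 2 \<Rightarrow> real ^ 4 \<Rightarrow> real ^ 4 \<Rightarrow> real ^ 4 \<Rightarrow> real ^ 4)
      (\<alpha> :: nat ^ 2 \<Rightarrow> real ^ 4 \<Rightarrow> real ^ 4) (\<beta> :: nat ^ 2 \<Rightarrow> real ^ 4 \<Rightarrow> real ^ 4).
    (\<forall>\<theta> x y z. ((\<lambda>i. multi_power \<theta> i *\<^sub>R bracket i x y z) has_sum deformed_cross4 \<theta> x y z) UNIV) \<and>
    (\<forall>\<theta> x. ((\<lambda>i. multi_power \<theta> i *\<^sub>R \<alpha> i x) has_sum rot \<theta> x) UNIV) \<and>
    (\<forall>\<theta> x. ((\<lambda>i. multi_power \<theta> i *\<^sub>R \<beta> i x) has_sum rot \<theta> x) UNIV) \<and>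
    formal_hom_nambu_lie_deformation scaleR cross4 id id bracket \<alpha> \<beta>"
proof -
  \<comment> \<open>The cross product itself is independent of \<theta>, so the bracket coefficients
    are the rotation coefficients applied to it; both twisting maps have the coefficients
    \<open>rot_coeff\<close>.\<close>
  let ?bracket = "\<lambda>i x y z. rot_coeff i (cross4 x y z)"
  have "module_hom scaleR scaleR (\<lambda>x. rot_coeff i (g x))" if "module_hom scaleR scaleR g"
    for i and g :: "real ^ 4 \<Rightarrow> real ^ 4"
    using module_hom_compose[OF that module_hom_rot_coeff[of i]] by (simp add: o_def)
  then have "trilinear scaleR (?bracket i)" for i
    using ternary_hom_nambu_lie_algebra.trilinear_bracket[OF cross4_algebra]
    by (simp add: trilinear_def)
  then have "formal_hom_nambu_lie_deformation scaleR cross4 id id ?bracket rot_coeff rot_coeff"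
    by (intro formal_hom_nambu_lie_deformation.intro formal_hom_nambu_lie_deformation_axioms.intro
        cross4_algebra formal_cross4_algebra module_hom_rot_coeff)
      (simp_all add: rot_coeff_0)
  moreover have "((\<lambda>i. multi_power \<theta> i *\<^sub>R ?bracket i x y z) has_sum deformed_cross4 \<theta> x y z) UNIV"
    for \<theta> x y z
    unfolding deformed_cross4_def by (rule has_sum_rot_coeff)
  ultimately show ?thesis
    using has_sum_rot_coeff
    by (intro exI[of _ ?bracket] exI[of _ rot_coeff] conjI allI)
qed

end
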